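(* There exists a subset of $2^\omega$ with the Grinzing property.
   Context: A subset $W$ of $2^\omega$ has the Grinzing property if $W$ is uncountable and for every uncountable $Y\subseteq W$ there exist uncountable subsets $Y_\alpha$ of $Y$, for $\alpha\in\omega_1$, such that $\mathrm{cl}(Y_\alpha)\cap\mathrm{cl}(Y_\beta)=\varnothing$ whenever $\alpha\neq\beta$, where the closure is taken in $2^\omega$. The result is a theorem of $\mathsf{ZFC}$. *)

theory Defs
  imports "HOL-Analysis.Analysis"
begin

(* The Cantor space 2^omega is the type "nat \<Rightarrow> bool" with its library topology: the product
   topology on functions over the order topology of bool, which is discrete. *)

(* omega_1 as a set of indices: the field of the cardinal successor of the well-order natLeq
   of omega. The elements happen to be of type "nat set", which is only the carrier type
   provided by cardSuc. *)
definition omega1 :: "nat set set" where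
  "omega1 = Field (cardSuc natLeq)"

definition Grinzing :: "(nat \<Rightarrow> bool) set \<Rightarrow> bool" where
  "Grinzing W \<longleftrightarrow>
     uncountable W \<and>
     (\<forall>Y \<subseteq> W. uncountable Y \<longrightarrow>
        (\<exists>Z :: nat set \<Rightarrow> (nat \<Rightarrow> bool) set.
           (\<forall>\<alpha> \<in> omega1. Z \<alpha> \<subseteq> Y \<and> uncountable (Z \<alpha>)) \<and>
           (\<forall>\<alpha> \<in> omega1. \<forall>\<beta> \<in> omega1. \<alpha> \<noteq> \<beta> \<longrightarrow> closure (Z \<alpha>) \<inter> closure (Z \<beta>) = {})))"

end

theory Submission
  imports Defs "HOL-Library.Countable_Set_Type"
begin

text \<open>Let \<open>x\<^sub>\<alpha>\<close> code an enumeration of the countable set of all ordinals up to \<open>\<alpha>\<close>, an element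
  of \<open>(2\<^sup>\<omega>)\<^sup>\<omega>\<close> once countable ordinals are identified with distinct reals. Given uncountably many
  \<open>x\<^sub>\<alpha>\<close>, every \<open>\<xi>\<close> occurs at one fixed position \<open>n\<^sub>\<xi>\<close> in uncountably many of them, and one \<open>n\<close> equals
  \<open>n\<^sub>\<xi>\<close> for uncountably many \<open>\<xi>\<close>. The condition that the \<open>n\<close>-th entry be \<open>\<xi>\<close> is closed, and these
  conditions are mutually exclusive for distinct \<open>\<xi>\<close>, as in an Ulam matrix.\<close>

unbundle cardinal_syntax

text \<open>Splits a point of the Cantor space into countably many rows. The elements of
  \<open>omega1\<close> have type \<open>nat set\<close>, so an ordinal is itself a possible
  row.\<close>

definition section_of :: "nat \<Rightarrow> (nat \<Rightarrow> bool) \<Rightarrow> nat set" where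
  "section_of n x = {k. x (prod_encode (n, k))}"

definition code_of :: "(nat \<Rightarrow> nat set) \<Rightarrow> nat \<Rightarrow> bool" where
  "code_of f = (\<lambda>m. snd (prod_decode m) \<in> f (fst (prod_decode m)))"

lemma section_of_code_of [simp]: "section_of n (code_of f) = f n"
  by (simp add: section_of_def code_of_def)

text \<open>Fixing a whole row fixes each of its coordinates separately, so the set is an
  intersection of closed conditions on single coordinates.\<close>

lemma closed_section_of: "closed {x. section_of n x = S}"
proof -
  have "closed {x::nat \<Rightarrow> bool. x (prod_encode (n, k)) = (k \<in> S)}" for k
    by (intro closed_Collect_eq continuous_intros continuous_on_product_coordinates)
  then have "closed {x. \<forall>k. x (prod_encode (n, k)) = (k \<in> S)}"
    by (intro closed_Collect_all)
  then show ?thesis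
    by (simp add: section_of_def set_eq_iff)
qed

abbreviation omega1_le :: "nat set rel" where
  "omega1_le \<equiv> cardSuc natLeq"

lemma Card_order_omega1: "Card_order omega1_le"
  by (simp add: cardSuc_Card_order natLeq_Card_order)

text \<open>The successor of \<omega> is the least cardinal above it. Serves to reindex an
  uncountable set of ordinals by all of \<open>omega1\<close>.\<close>

lemma uncountable_imp_inj_omega1:
  assumes "uncountable B"
  shows "\<exists>h. inj_on h omega1 \<and> h ` omega1 \<subseteq> B"
proof -
  have "natLeq <o |B|"
    using assms not_ordLeq_iff_ordLess [OF natLeq_Well_order card_of_Well_order [of B]]
    by (simp add: countable_card_le_natLeq)
  then have "omega1_le \<le>o |B|"
    by (intro cardSuc_least natLeq_Card_order card_of_Card_order)
  then have "|omega1| \<le>o |B|"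
    using ordIso_ordLeq_trans [OF card_of_Field_ordIso [OF Card_order_omega1]]
    by (simp add: omega1_def)
  then show ?thesis
    by (simp add: card_of_ordLeq)
qed

lemma uncountable_omega1: "uncountable omega1"
proof
  assume "countable omega1"
  then have "|omega1| \<le>o natLeq"
    by (simp add: countable_card_le_natLeq)
  then have "omega1_le \<le>o natLeq"
    using ordIso_ordLeq_trans [OF ordIso_symmetric [OF card_of_Field_ordIso [OF Card_order_omega1]]]
    by (simp add: omega1_def)
  then show False
    using not_ordLess_ordLeq [OF cardSuc_greater [OF natLeq_Card_order]] by blast
qed

text \<open>A proper initial segment of a cardinal has smaller cardinality, and below the successor
  of \<omega> this means countable.\<close>

lemma countable_under_omega1:
  assumes "\<alpha> \<in> omega1"
  shows "countable (under omega1_le \<alpha>)"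
proof -
  have "|underS omega1_le \<alpha>| <o omega1_le"
    using assms Card_order_omega1 by (simp add: card_of_underS omega1_def)
  then have "countable (underS omega1_le \<alpha>)"
    by (simp add: countable_card_le_natLeq
        cardSuc_ordLeq_ordLess [OF natLeq_Card_order card_of_Card_order])
  moreover have "under omega1_le \<alpha> \<subseteq> insert \<alpha> (underS omega1_le \<alpha>)"
    by (auto simp: under_def underS_def)
  ultimately show ?thesis
    by (meson countable_insert countable_subset)
qed

lemma omega1_refl: "\<alpha> \<in> omega1 \<Longrightarrow> (\<alpha>, \<alpha>) \<in> omega1_le"
  and omega1_antisym: "(\<alpha>, \<beta>) \<in> omega1_le \<Longrightarrow> (\<beta>, \<alpha>) \<in> omega1_le \<Longrightarrow> \<alpha> = \<beta>"
  and omega1_total: "\<alpha> \<in> omega1 \<Longrightarrow> \<beta> \<in> omega1 \<Longrightarrow> (\<alpha>, \<beta>) \<in> omega1_le \<or> (\<beta>, \<alpha>) \<in> omega1_le"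
proof -
  have *: "Well_order omega1_le"
    using Card_order_omega1 card_order_on_well_order_on by blast
  show refl: "(\<alpha>, \<alpha>) \<in> omega1_le" if "\<alpha> \<in> omega1" for \<alpha>
    using * that by (auto simp: order_on_defs refl_on_def omega1_def)
  show "(\<alpha>, \<beta>) \<in> omega1_le \<Longrightarrow> (\<beta>, \<alpha>) \<in> omega1_le \<Longrightarrow> \<alpha> = \<beta>"
    using * by (auto simp: order_on_defs antisym_def)
  show "\<alpha> \<in> omega1 \<Longrightarrow> \<beta> \<in> omega1 \<Longrightarrow> (\<alpha>, \<beta>) \<in> omega1_le \<or> (\<beta>, \<alpha>) \<in> omega1_le"
    using * refl by (cases "\<alpha> = \<beta>") (auto simp: order_on_defs total_on_def omega1_def)
qed

text \<open>\<open>under\<close> contains \<alpha> itself, so for \<alpha> in \<open>omega1\<close>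
  the enumerated set is nonempty and \<open>from_nat_into\<close> maps onto it, possibly with
  repetitions if it is finite.\<close>

definition omega1_code :: "nat set \<Rightarrow> nat \<Rightarrow> bool" where
  "omega1_code \<alpha> = code_of (from_nat_into (under omega1_le \<alpha>))"

lemma range_section_of_omega1_code:
  assumes "\<alpha> \<in> omega1"
  shows "range (\<lambda>n. section_of n (omega1_code \<alpha>)) = under omega1_le \<alpha>"
proof -
  have "under omega1_le \<alpha> \<noteq> {}"
    using omega1_refl [OF assms] by (auto simp: under_def)
  then show ?thesis
    using countable_under_omega1 [OF assms] by (simp add: omega1_code_def)
qed

text \<open>The rows of a code determine the initial segment, and \<alpha> is its greatest
  element.\<close>

lemma inj_on_omega1_code: "inj_on omega1_code omega1"
proof (rule inj_onI)
  fix \<alpha> \<beta> assume *: "\<alpha> \<in> omega1" "\<beta> \<in> omega1" "omega1_code \<alpha> = omega1_code \<beta>"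
  then have "under omega1_le \<alpha> = under omega1_le \<beta>"
    by (metis range_section_of_omega1_code)
  then have "(\<alpha>, \<beta>) \<in> omega1_le" "(\<beta>, \<alpha>) \<in> omega1_le"
    using omega1_refl *(1,2) by (auto simp: under_def)
  then show "\<alpha> = \<beta>"
    by (rule omega1_antisym)
qed

lemma uncountable_fibre:
  fixes f :: "'a \<Rightarrow> 'b::countable"
  assumes "uncountable A"
  shows "\<exists>n. uncountable {a \<in> A. f a = n}"
proof (rule ccontr)
  assume "\<not> ?thesis"
  then have "countable (\<Union>n. {a \<in> A. f a = n})"
    by (intro countable_UN) auto
  moreover have "(\<Union>n. {a \<in> A. f a = n}) = A"
    by auto
  ultimately show False
    using assms by simp
qed

text \<open>Every code of an ordinal above \<xi> has \<xi> among its rows, and only countably many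
  codes belong to ordinals up to \<xi>. The position of \<xi> is then constant on an uncountable
  set.\<close>

lemma uncountable_section_of_omega1_code:
  assumes Y: "Y \<subseteq> omega1_code ` omega1" "uncountable Y" and \<xi>: "\<xi> \<in> omega1"
  shows "\<exists>n. uncountable {x \<in> Y. section_of n x = \<xi>}"
proof -
  define Y' where "Y' = Y - omega1_code ` under omega1_le \<xi>"
  have "\<exists>n. section_of n x = \<xi>" if "x \<in> Y'" for x
  proof -
    obtain \<alpha> where \<alpha>: "\<alpha> \<in> omega1" "x = omega1_code \<alpha>" "(\<alpha>, \<xi>) \<notin> omega1_le"
      using \<open>x \<in> Y'\<close> Y by (auto simp: Y'_def under_def)
    then have "\<xi> \<in> under omega1_le \<alpha>"
      using omega1_total \<xi> by (auto simp: under_def)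
    then have "\<xi> \<in> range (\<lambda>n. section_of n x)"
      using range_section_of_omega1_code [OF \<alpha>(1)] \<alpha>(2) by simp
    then show ?thesis
      by blast
  qed
  then obtain p where p: "\<And>x. x \<in> Y' \<Longrightarrow> section_of (p x) x = \<xi>"
    by metis
  have "uncountable Y'"
    unfolding Y'_def using Y(2) countable_under_omega1 [OF \<xi>]
    by (intro uncountable_minus_countable countable_image)
  then obtain n where n: "uncountable {x \<in> Y'. p x = n}"
    using uncountable_fibre by blast
  have "{x \<in> Y'. p x = n} \<subseteq> {x \<in> Y. section_of n x = \<xi>}"
    using p by (auto simp: Y'_def)
  with n show ?thesis
    using countable_subset by blast
qed

theorem corollary11:
  shows "\<exists>W :: (nat \<Rightarrow> bool) set. Grinzing W"
proof
  show "Grinzing (omega1_code ` omega1)"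
    unfolding Grinzing_def
  proof (intro conjI allI impI)
    show "uncountable (omega1_code ` omega1)"
      using uncountable_omega1 inj_on_omega1_code countable_image_inj_on by blast
  next
    fix Y assume "Y \<subseteq> omega1_code ` omega1" "uncountable Y"
    then obtain p where p: "\<And>\<xi>. \<xi> \<in> omega1 \<Longrightarrow> uncountable {x \<in> Y. section_of (p \<xi>) x = \<xi>}"
      using uncountable_section_of_omega1_code by metis
    \<comment> \<open>With one common row \<open>n\<close>, the conditions for different \<xi>
      exclude each other; conditions on different rows need not.\<close>
    obtain n :: nat where "uncountable {\<xi> \<in> omega1. p \<xi> = n}"
      using uncountable_fibre uncountable_omega1 by blast
    then obtain h where h: "inj_on h omega1" "h ` omega1 \<subseteq> {\<xi> \<in> omega1. p \<xi> = n}"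
      using uncountable_imp_inj_omega1 by metis
    define Z where "Z \<alpha> = {x \<in> Y. section_of n x = h \<alpha>}" for \<alpha>
    have closure_Z: "closure (Z \<alpha>) \<subseteq> {x. section_of n x = h \<alpha>}" for \<alpha>
      by (intro closure_minimal closed_section_of) (auto simp: Z_def)
    have "closure (Z \<alpha>) \<inter> closure (Z \<beta>) = {}"
      if "\<alpha> \<in> omega1" "\<beta> \<in> omega1" "\<alpha> \<noteq> \<beta>" for \<alpha> \<beta>
    proof -
      have "h \<alpha> \<noteq> h \<beta>"
        using inj_on_eq_iff [OF h(1) that(1,2)] that(3) by simp
      then show ?thesis
        using closure_Z [of \<alpha>] closure_Z [of \<beta>] by blast
    qed
    moreover have "uncountable (Z \<alpha>)" if "\<alpha> \<in> omega1" for \<alpha>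
      \<comment> \<open>Since \<open>p (h \<alpha>) = n\<close>, the set \<open>Z \<alpha>\<close>
        is the one that \<open>p\<close> provides for the ordinal \<open>h \<alpha>\<close>.\<close>
      using p [of "h \<alpha>"] h(2) that by (auto simp: Z_def)
    moreover have "Z \<alpha> \<subseteq> Y" for \<alpha>
      by (auto simp: Z_def)
    ultimately show "\<exists>Z. (\<forall>\<alpha>\<in>omega1. Z \<alpha> \<subseteq> Y \<and> uncountable (Z \<alpha>)) \<and>
        (\<forall>\<alpha>\<in>omega1. \<forall>\<beta>\<in>omega1. \<alpha> \<noteq> \<beta> \<longrightarrow> closure (Z \<alpha>) \<inter> closure (Z \<beta>) = {})"
      by (intro exI [of _ Z]) simp
  qed
qed

end
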